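(* Let $A \in \{0,\star\}^{d\times d}$ and $B\in\{0,\star\}^{d\times m}$ be such that $(A,B)$ is structurally controllable, let each nonzero entry $B_{ij}$ carry a cost $w_{ij}\ge 0$, and suppose that the bipartite graph $\Gamma(A)$ has a perfect matching. Then the matrix $B^{*}$ produced by the SSCC-selection algorithm (described in the context) solves the problem $\min_{B'\in\mathcal{K}}\|B'\|_w$; that is, $B^{*}\in\mathcal{K}$ and $\|B^{*}\|_w\le\|B'\|_w$ for all $B'\in\mathcal{K}$.
   Context: A matrix with entries in $\{0,\star\}$ is a sparsity matrix: each entry is either a fixed zero or an independent free parameter $\star$. A numerical realization is obtained by assigning real values to the $\star$ entries (zeros stay zero). The pair $(A,B)$ with $A\in\{0,\star\}^{d\times d}$, $B\in\{0,\star\}^{d\times m}$ is structurally controllable if there is at least one numerical realization $(A',B')$ of $(A,B)$ such that the linear system $\dot x = A'x+B'u$ is controllable. $Z(B)=\{(i,j) : B_{ij}=0\}$, and $\mathcal{K}$ is the set of all $B'\in\{0,\star\}^{d\times m}$ with $Z(B)\subset Z(B')$ and $(A,B')$ structurally controllable. For $B'\in\mathcal{K}$, $\|B'\|_w=\sum_{(i,j): B'_{ij}\ne0} w_{ij}$. $G(A)$ is the digraph with vertex set $\{v_1,\dots,v_d\}$ and a directed edge $(v_j,v_i)$ whenever $A_{ij}\neq 0$. A strongly connected component (SCC) is a maximal strongly connected subgraph of $G(A)$; it is a source strongly connected component (SSCC) if there is no directed edge from a vertex of another SCC into any of its vertices. $\Gamma(A)$ is the undirected bipartite graph with parts $V_A^1=\{v_1^1,\dots,v_d^1\}$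 and $V_A^2=\{v_1^2,\dots,v_d^2\}$ and edges $(v_j^1,v_i^2)$ whenever $A_{ij}\neq0$. A matching is perfect if it saturates all vertices. SSCC-selection algorithm. Set $w_{ij}=\infty$ whenever $B_{ij}=0$ (for practical purposes, $w_{ij}=w_{\max}+1$, where $w_{\max}$ is the largest cost of a nonzero entry of $B$). Determine the SSCCs $\mathcal{S}_1,\dots,\mathcal{S}_q$ of $G(A)$ and set $L=\emptyset$. For each $\mathcal{S}_j$: for each state vertex $v_i\in\mathcal{S}_j$ choose the smallest cost $w_{ik}$ among $w_{i1},\dots,w_{im}$; then among all $v_i\in\mathcal{S}_j$ choose a vertex $v_\ell$ whose chosen cost $w_{\ell k}$ is least (ties broken arbitrarily), and add $(u_k,v_\ell)$ to $L$. Output $B^{*}\in\{0,\star\}^{d\times m}$ with $B^{*}_{\ell k}=\star$ if $(u_k,v_\ell)\in L$ and $B^{*}_{\ell k}=0$ otherwise. *)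

theory Defs
  imports
    "HOL-Analysis.Analysis"
    "HOL-Library.Extended_Real"
    "Graph_Theory.Digraph_Component"
begin

section \<open>Sparsity matrices and structural controllability\<close>

datatype entry = Fixed_Zero | Star

definition realization :: "real ^ 'n ^ 'm \<Rightarrow> entry ^ 'n ^ 'm \<Rightarrow> bool" where
  "realization M' M \<longleftrightarrow> (\<forall>i j. M $ i $ j = Fixed_Zero \<longrightarrow> M' $ i $ j = 0)"

text \<open>
  A trajectory of \<open>x' = A x + B u\<close> on \<open>[0, T]\<close> in the Caratheodory sense: the input is
  Lebesgue integrable and the differential equation is stated in its integrated form.
\<close>

definition trajectory ::
  "real ^ 'd ^ 'd \<Rightarrow> real ^ 'm ^ 'd \<Rightarrow> real \<Rightarrow> (real \<Rightarrow> real ^ 'm) \<Rightarrow> (real \<Rightarrow> real ^ 'd) \<Rightarrow> bool" where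
  "trajectory A B T u x \<longleftrightarrow>
     u absolutely_integrable_on {0..T} \<and>
     (\<forall>t\<in>{0..T}. ((\<lambda>s. A *v x s + B *v u s) has_integral (x t - x 0)) {0..t})"

definition controllable :: "real ^ 'd ^ 'd \<Rightarrow> real ^ 'm ^ 'd \<Rightarrow> bool" where
  "controllable A B \<longleftrightarrow>
     (\<forall>x0 x1. \<exists>T>0. \<exists>u x. trajectory A B T u x \<and> x 0 = x0 \<and> x T = x1)"

definition structurally_controllable :: "entry ^ 'd ^ 'd \<Rightarrow> entry ^ 'm ^ 'd \<Rightarrow> bool" where
  "structurally_controllable A B \<longleftrightarrow>
     (\<exists>A' B'. realization A' A \<and> realization B' B \<and> controllable A' B')"

section \<open>The optimization problem\<close>

definition zeros :: "entry ^ 'm ^ 'd \<Rightarrow> ('d \<times> 'm) set" where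
  "zeros B = {(i, j). B $ i $ j = Fixed_Zero}"

text \<open>The set \<open>K\<close>; the inclusion of zero patterns is not strict, so \<open>B\<close> itself is a candidate.\<close>

definition feasible :: "entry ^ 'd ^ 'd \<Rightarrow> entry ^ 'm ^ 'd \<Rightarrow> (entry ^ 'm ^ 'd) set" where
  "feasible A B = {B'. zeros B \<subseteq> zeros B' \<and> structurally_controllable A B'}"

definition weighted_norm :: "real ^ 'm ^ 'd \<Rightarrow> entry ^ 'm ^ 'd \<Rightarrow> real" where
  "weighted_norm w B' = (\<Sum>(i, j) \<in> {(i, j). B' $ i $ j \<noteq> Fixed_Zero}. w $ i $ j)"

section \<open>The graphs of a square sparsity matrix\<close>

definition state_digraph :: "entry ^ 'd ^ 'd \<Rightarrow> ('d, 'd \<times> 'd) pre_digraph" where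
  "state_digraph A =
     \<lparr> verts = UNIV, arcs = {(j, i). A $ i $ j \<noteq> Fixed_Zero}, tail = fst, head = snd \<rparr>"

definition source_sccs :: "('a, 'b) pre_digraph \<Rightarrow> ('a, 'b) pre_digraph set" where
  "source_sccs G = {S \<in> pre_digraph.sccs G.
     \<not> (\<exists>S' \<in> pre_digraph.sccs G. S' \<noteq> S \<and>
          (\<exists>e \<in> arcs G. tail G e \<in> verts S' \<and> head G e \<in> verts S))}"

text \<open>
  The bipartite graph of \<open>A\<close>: \<open>Inl j\<close> and \<open>Inr i\<close> are the copies of the vertices \<open>j\<close> and \<open>i\<close>
  in the first and in the second part, and undirected edges are two-element sets.
\<close>

definition bipartite_edges :: "entry ^ 'd ^ 'd \<Rightarrow> ('d + 'd) set set" where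
  "bipartite_edges A = {{Inl j, Inr i} | i j. A $ i $ j \<noteq> Fixed_Zero}"

definition matching :: "'v set set \<Rightarrow> 'v set set \<Rightarrow> bool" where
  "matching E M \<longleftrightarrow> M \<subseteq> E \<and> (\<forall>e\<in>M. \<forall>f\<in>M. e \<noteq> f \<longrightarrow> e \<inter> f = {})"

definition has_perfect_matching :: "'v set \<Rightarrow> 'v set set \<Rightarrow> bool" where
  "has_perfect_matching V E \<longleftrightarrow> (\<exists>M. matching E M \<and> (\<forall>v\<in>V. \<exists>e\<in>M. v \<in> e))"

section \<open>The SSCC-selection algorithm\<close>

definition extended_cost :: "entry ^ 'm ^ 'd \<Rightarrow> real ^ 'm ^ 'd \<Rightarrow> 'd \<Rightarrow> 'm \<Rightarrow> ereal" where
  "extended_cost B w i j = (if B $ i $ j = Fixed_Zero then \<infinity> else ereal (w $ i $ j))"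

text \<open>
  Since ties are broken arbitrarily, the algorithm is a relation: \<open>k i\<close> is the input chosen for the
  state vertex \<open>i\<close>, and \<open>l S\<close> is the state vertex chosen in the component \<open>S\<close>. Pairs in \<open>L\<close> are
  (input, state vertex), whereas matrices are indexed by row (state) first.
\<close>

definition sscc_selection ::
  "entry ^ 'd ^ 'd \<Rightarrow> entry ^ 'm ^ 'd \<Rightarrow> real ^ 'm ^ 'd \<Rightarrow> ('m \<times> 'd) set \<Rightarrow> bool" where
  "sscc_selection A B w L \<longleftrightarrow>
     (\<exists>k l.
        (\<forall>S \<in> source_sccs (state_digraph A).
           (\<forall>i \<in> verts S. is_arg_min (extended_cost B w i) (\<lambda>_. True) (k i)) \<and>
           is_arg_min (\<lambda>i. extended_cost B w i (k i)) (\<lambda>i. i \<in> verts S) (l S)) \<and>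
        L = {(k (l S), l S) | S. S \<in> source_sccs (state_digraph A)})"

definition sscc_algorithm_output ::
  "entry ^ 'd ^ 'd \<Rightarrow> entry ^ 'm ^ 'd \<Rightarrow> real ^ 'm ^ 'd \<Rightarrow> entry ^ 'm ^ 'd \<Rightarrow> bool" where
  "sscc_algorithm_output A B w Bs \<longleftrightarrow>
     (\<exists>L. sscc_selection A B w L \<and>
          Bs = (\<chi> i j. if (j, i) \<in> L then Star else Fixed_Zero))"

lemma sscc_algorithm_output_exists:
  fixes A :: "entry ^ 'd ^ 'd" and B :: "entry ^ 'm ^ 'd" and w :: "real ^ 'm ^ 'd"
  shows "\<exists>Bs. sscc_algorithm_output A B w Bs"
proof -
  have ex: "\<exists>a. is_arg_min f (\<lambda>a. a \<in> X) a"
    if "X \<noteq> {}" for f :: "'x::finite \<Rightarrow> ereal" and X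
    using ex_is_arg_min_if_finite[of X f] that by auto
  have "\<exists>k. \<forall>i. is_arg_min (extended_cost B w i) (\<lambda>_. True) (k i)"
    using ex[of UNIV] by (intro choice) auto
  then obtain k where k: "\<And>i. is_arg_min (extended_cost B w i) (\<lambda>_. True) (k i)"
    by blast
  have "\<exists>l. \<forall>S \<in> source_sccs (state_digraph A).
          is_arg_min (\<lambda>i. extended_cost B w i (k i)) (\<lambda>i. i \<in> verts S) (l S)"
    by (intro bchoice ballI ex)
       (auto simp: source_sccs_def pre_digraph.sccs_def strongly_connected_def)
  then obtain l where
    "\<forall>S \<in> source_sccs (state_digraph A).
       is_arg_min (\<lambda>i. extended_cost B w i (k i)) (\<lambda>i. i \<in> verts S) (l S)"
    by blast
  with k have "sscc_selection A B w {(k (l S), l S) | S. S \<in> source_sccs (state_digraph A)}"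
    unfolding sscc_selection_def by blast
  then show ?thesis
    unfolding sscc_algorithm_output_def by blast
qed

end

theory Submission
  imports Defs
    "HOL-Computational_Algebra.Fundamental_Theorem_Algebra"
    "HOL-Combinatorics.Orbits"
begin

text \<open>
  Optimality: inside a source component no state is driven from outside except by an input attached
  to it, so by Gronwall a component without input stays at rest. Hence every feasible pattern has
  an entry in the rows of each source component, and the algorithm picks a cheapest one.

  Feasibility: a perfect matching is a permutation of the states along edges, i.e. it splits them
  into disjoint cycles. All edges of one cycle get the same weight, so the eigenvalues of a cycle lie
  on a circle of that radius. The cycles are added one at a time, each with a fresh radius and a single
  unit edge from an input or from an earlier cycle. A left eigenvector orthogonal to the inputs
  would have to live on circles where the transfer function into that edge vanishes, which the
  choice of the radius excludes; so the Hautus test succeeds.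
\<close>

section \<open>Controllability from observability of the dual\<close>

definition linear_flow :: "('a::euclidean_space \<Rightarrow> 'a) \<Rightarrow> real \<Rightarrow> 'a \<Rightarrow> 'a" where
  "linear_flow f t z = (\<Sum>n. (t ^ n / fact n) *\<^sub>R (f ^^ n) z)"

lemma linear_funpow:
  fixes f :: "'a::real_vector \<Rightarrow> 'a"
  assumes "linear f"
  shows "linear (f ^^ n)"
proof (induction n)
  case (Suc n)
  show ?case
    using linear_compose[OF Suc assms] by (simp add: o_def)
qed (simp add: linear_id[unfolded id_def])

lemma summable_linear_flow:
  fixes f :: "'a::euclidean_space \<Rightarrow> 'a"
  assumes "linear f"
  shows "summable (\<lambda>n. (t ^ n / fact n) *\<^sub>R (f ^^ n) z)"
proof -
  obtain K where "K > 0" and K: "\<And>x. norm (f x) \<le> K * norm x"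
    using linear_bounded_pos[OF assms] by blast
  have bound: "norm ((f ^^ n) z) \<le> K ^ n * norm z" for n
  proof (induction n)
    case (Suc n)
    have "norm ((f ^^ Suc n) z) \<le> K * norm ((f ^^ n) z)"
      using K by simp
    also have "\<dots> \<le> K * (K ^ n * norm z)"
      using Suc \<open>K > 0\<close> by (intro mult_left_mono) auto
    finally show ?case
      by (simp add: mult.assoc)
  qed simp
  have "norm ((t ^ n / fact n) *\<^sub>R (f ^^ n) z) \<le> inverse (fact n) * (\<bar>t\<bar> * K) ^ n * norm z" for n
    using mult_left_mono[OF bound[of n], of "\<bar>t\<bar> ^ n / fact n"]
    by (simp add: power_abs power_mult_distrib field_simps)
  then show ?thesis
    by (intro summable_comparison_test[OF _ summable_mult2[OF summable_exp]]) auto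
qed

lemma linear_linear_flow:
  fixes f :: "'a::euclidean_space \<Rightarrow> 'a"
  assumes "linear f"
  shows "linear (linear_flow f t)"
proof (rule linearI)
  note S = summable_linear_flow[OF assms, of t]
  show "linear_flow f t (y + z) = linear_flow f t y + linear_flow f t z" for y z
    unfolding linear_flow_def suminf_add[OF S S]
    by (simp add: linear_add[OF linear_funpow[OF assms]] scaleR_add_right)
  show "linear_flow f t (c *\<^sub>R z) = c *\<^sub>R linear_flow f t z" for c z
    unfolding linear_flow_def suminf_scaleR_right[OF S]
    by (simp add: linear_scale[OF linear_funpow[OF assms]] mult.commute)
qed

lemma linear_flow_0 [simp]: "linear_flow f 0 z = z"
proof -
  have "(\<lambda>n. (0 ^ n / fact n) *\<^sub>R (f ^^ n) z) = (\<lambda>n. if n = 0 then z else 0)"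
    by (auto simp: fun_eq_iff)
  then show ?thesis
    using sums_single[of 0 "\<lambda>_. z"] by (simp add: linear_flow_def sums_iff)
qed

text \<open>Each component of the flow is a scalar power series converging everywhere, so it may be
  differentiated term by term; the index shift in \<open>diffs\<close> brings out one more factor
  \<open>f\<close>.\<close>

lemma linear_flow_has_vector_derivative:
  fixes f :: "'a::euclidean_space \<Rightarrow> 'a"
  assumes "linear f"
  shows "((\<lambda>t. linear_flow f t z) has_vector_derivative f (linear_flow f t z)) (at t)"
proof -
  note S = summable_linear_flow[OF assms]
  have "((\<lambda>t. linear_flow f t z \<bullet> b) has_field_derivative f (linear_flow f t z) \<bullet> b) (at t)" for b
  proof -
    define c where "c n = (f ^^ n) z \<bullet> b / fact n" for n
    have comp: "(\<lambda>n. ((s ^ n / fact n) *\<^sub>R (f ^^ n) z) \<bullet> b) = (\<lambda>n. c n * s ^ n)" for s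
      by (auto simp: c_def)
    have flow: "linear_flow f s z \<bullet> b = (\<Sum>n. c n * s ^ n)" for s
      unfolding linear_flow_def comp[symmetric]
      by (rule bounded_linear.suminf[OF bounded_linear_inner_left S])
    have "summable (\<lambda>n. c n * s ^ n)" for s
      unfolding comp[symmetric] by (rule bounded_linear.summable[OF bounded_linear_inner_left S])
    then have D: "((\<lambda>s. \<Sum>n. c n * s ^ n) has_field_derivative (\<Sum>n. diffs c n * t ^ n)) (at t)"
      by (rule termdiffs_strong_converges_everywhere)
    have bl: "bounded_linear (\<lambda>x. f x \<bullet> b)"
      using assms by (intro bounded_linear_compose[OF bounded_linear_inner_left] linear_linear[THEN iffD2])
    have "f (linear_flow f t z) \<bullet> b = (\<Sum>n. f ((t ^ n / fact n) *\<^sub>R (f ^^ n) z) \<bullet> b)"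
      unfolding linear_flow_def by (rule bounded_linear.suminf[OF bl S])
    also have "\<dots> = (\<Sum>n. diffs c n * t ^ n)"
      by (intro arg_cong[where f = suminf])
         (auto simp: diffs_def c_def fun_eq_iff linear_scale[OF assms] field_simps simp del: of_nat_Suc)
    finally show ?thesis
      using D by (simp add: flow)
  qed
  moreover have "(\<lambda>h. (h *\<^sub>R v) \<bullet> b) = (*) (v \<bullet> b)" for v b :: 'a
    by (rule ext) (simp only: inner_scaleR_left mult.commute)
  ultimately have "((\<lambda>t. linear_flow f t z \<bullet> b) has_derivative (\<lambda>h. (h *\<^sub>R f (linear_flow f t z)) \<bullet> b)) (at t)" for b
    by (simp only: has_field_derivative_def)
  then show ?thesis
    unfolding has_vector_derivative_def
    by - (rule has_derivative_componentwise_within[THEN iffD2], blast)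
qed

lemma trajectoryI:
  fixes A :: "real ^ 'd ^ 'd" and B :: "real ^ 'm ^ 'd"
  assumes "continuous_on {0..T} u"
    and "\<And>t. (x has_vector_derivative (A *v x t + B *v u t)) (at t)"
  shows "trajectory A B T u x"
  unfolding trajectory_def
proof (intro conjI ballI)
  show "u absolutely_integrable_on {0..T}"
    using assms(1) by (rule absolutely_integrable_continuous_real)
  show "((\<lambda>s. A *v x s + B *v u s) has_integral (x t - x 0)) {0..t}" if "t \<in> {0..T}" for t
    using that assms(2)
    by (intro fundamental_theorem_of_calculus) (auto intro: has_vector_derivative_at_within)
qed

text \<open>The observability matrix of the dual pair \<open>(transpose A, transpose B)\<close>,
  with blocks of every order, has trivial kernel. Ranging over all powers suits both repeated
  differentiation and the invariance of the unobservable subspace.\<close>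

definition observable :: "real ^ 'd ^ 'd \<Rightarrow> real ^ 'm ^ 'd \<Rightarrow> bool" where
  "observable A B \<longleftrightarrow>
     (\<forall>v. (\<forall>n. transpose B *v ((\<lambda>w. transpose A *v w) ^^ n) v = 0) \<longrightarrow> v = 0)"

text \<open>
  The optimal-control system \<open>x' = A x + B B\<^sup>T y\<close>, \<open>y' = - A\<^sup>T y\<close> steers \<open>x\<close> with input
  \<open>B\<^sup>T y\<close>; along it \<open>(x \<bullet> y)' = |B\<^sup>T y|\<^sup>2\<close>, so the map from \<open>y 0\<close> to \<open>x 1\<close> with \<open>x 0 = 0\<close> is injective.
\<close>

lemma observable_imp_controllable:
  fixes A :: "real ^ 'd ^ 'd" and B :: "real ^ 'm ^ 'd"
  assumes "observable A B"
  shows "controllable A B"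
proof -
  define f :: "(real ^ 'd) \<times> (real ^ 'd) \<Rightarrow> (real ^ 'd) \<times> (real ^ 'd)" where
    "f = (\<lambda>(x, y). (A *v x + B *v (transpose B *v y), - (transpose A *v y)))"
  have lin: "linear f"
    by (rule linearI)
       (auto simp: f_def vec_eq_iff vector_matrix_mult_def matrix_vector_mult_def sum_distrib_left sum.distrib algebra_simps)
  define X where "X t z = fst (linear_flow f t z)" for t z
  define Y where "Y t z = snd (linear_flow f t z)" for t z
  have D: "((\<lambda>t. linear_flow f t z) has_vector_derivative
      (A *v X t z + B *v (transpose B *v Y t z), - (transpose A *v Y t z))) (at t)" for t z
    using linear_flow_has_vector_derivative[OF lin, of z t]
    by (simp add: f_def X_def Y_def case_prod_unfold)
  have DX: "((\<lambda>t. X t z) has_vector_derivative (A *v X t z + B *v (transpose B *v Y t z))) (at t)" for t z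
    using bounded_linear.has_vector_derivative[OF bounded_linear_fst D[of z t]] by (simp add: X_def)
  have DY: "((\<lambda>t. Y t z) has_vector_derivative (- (transpose A *v Y t z))) (at t)" for t z
    using bounded_linear.has_vector_derivative[OF bounded_linear_snd D[of z t]] by (simp add: Y_def)
  have contY: "continuous_on S (\<lambda>t. Y t z)" for z S
    using DY by (intro continuous_at_imp_continuous_on) (blast intro: has_vector_derivative_continuous)
  have traj: "trajectory A B 1 (\<lambda>t. transpose B *v Y t z) (\<lambda>t. X t z)" for z
    by (rule trajectoryI[OF _ DX])
       (intro linear_continuous_on_compose[OF contY] matrix_vector_mul_linear)
  have X0: "X 0 z = fst z" and Y0: "Y 0 z = snd z" for z
    by (simp_all add: X_def Y_def)
  have linX: "linear (X 1)"
    unfolding X_def using linear_compose[OF linear_linear_flow[OF lin] linear_fst]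
    by (simp add: o_def)
  have inj: "v = 0" if "X 1 (0, v) = 0" for v
  proof -
    define x y where "x t = X t (0, v)" and "y t = Y t (0, v)" for t
    define N where "N = (\<lambda>w. transpose A *v w)"
    have Dxy: "((\<lambda>t. x t \<bullet> y t) has_real_derivative (norm (transpose B *v y t))\<^sup>2) (at t)" for t
    proof -
      have "((\<lambda>t. x t \<bullet> y t) has_vector_derivative
          x t \<bullet> (- (transpose A *v y t)) + (A *v x t + B *v (transpose B *v y t)) \<bullet> y t) (at t)"
        unfolding x_def y_def
        by (rule bounded_bilinear.has_vector_derivative[OF bounded_bilinear_inner DX DY])
      moreover have "x t \<bullet> (- (transpose A *v y t)) + (A *v x t + B *v (transpose B *v y t)) \<bullet> y t
          = (norm (transpose B *v y t))\<^sup>2"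
        by (simp only: inner_add_left inner_minus_right power2_norm_eq_inner transpose_matrix_vector
            dot_lmul_matrix inner_commute[of "x t"] inner_commute[of "_ *v _" "y t"])
      ultimately show ?thesis
        by (simp add: has_real_derivative_iff_has_vector_derivative)
    qed
    have mono: "x s \<bullet> y s \<le> x t \<bullet> y t" if "s \<le> t" for s t
    proof (rule DERIV_nonneg_imp_nondecreasing[OF that])
      show "\<exists>D. ((\<lambda>t. x t \<bullet> y t) has_real_derivative D) (at r) \<and> 0 \<le> D" for r
        using Dxy[of r] zero_le_power2 by blast
    qed
    \<comment> \<open>The product vanishes at both ends, at 0 since \<open>x 0 = 0\<close> and at 1
      by assumption, so monotonicity squeezes it to zero in between.\<close>
    have const: "x t \<bullet> y t = 0" if "t \<in> {0..1}" for t
      using mono[of 0 t] mono[of t 1] that \<open>X 1 (0, v) = 0\<close> X0[of "(0, v)"] by (simp add: x_def)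
    have By: "transpose B *v y t = 0" if "t \<in> {0<..<1}" for t
    proof -
      have "((\<lambda>t. x t \<bullet> y t) has_real_derivative 0) (at t)"
      proof (rule has_field_derivative_transform_within_open)
        show "((\<lambda>_. 0) has_real_derivative 0) (at t)"
          by (rule DERIV_const)
        show "0 = x s \<bullet> y s" if "s \<in> {0<..<1}" for s
          using const[of s] that by simp
      qed (use that in simp_all)
      then show ?thesis
        using DERIV_unique[OF Dxy] by force
    qed
    \<comment> \<open>Each identity is differentiated in \<open>t\<close> using
      \<open>y' = - N y\<close>, which yields the next power; the open interval makes the
      derivatives two-sided.\<close>
    have BNy: "transpose B *v (N ^^ n) (y t) = 0" if "t \<in> {0<..<1}" for n t
      using that
    proof (induction n arbitrary: t)
      case (Suc n)
      define g where "g = (\<lambda>w. transpose B *v (N ^^ n) w)"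
      have "linear N"
        unfolding N_def by (rule matrix_vector_mul_linear)
      then have lin': "linear g"
        unfolding g_def
        by (rule linear_compose[OF linear_funpow matrix_vector_mul_linear, unfolded o_def])
      have "((\<lambda>t. g (y t)) has_vector_derivative g (- N (y t))) (at t)"
        using bounded_linear.has_vector_derivative[OF linear_linear[THEN iffD2, OF lin'] DY]
        unfolding y_def N_def .
      moreover have "((\<lambda>t. g (y t)) has_vector_derivative 0) (at t)"
      proof (rule has_vector_derivative_transform_within_open)
        show "((\<lambda>_. 0) has_vector_derivative 0) (at t)"
          by (rule has_vector_derivative_const)
        show "0 = g (y s)" if "s \<in> {0<..<1}" for s
          using Suc.IH[OF that] by (simp only: g_def)
      qed (use Suc.prems in simp_all)
      ultimately have "g (- N (y t)) = 0"
        by (rule vector_derivative_unique_at)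
      then have "g (N (y t)) = 0"
        by (simp only: linear_neg[OF lin'] neg_equal_0_iff_equal)
      then show ?case
        by (simp only: funpow_Suc_right o_apply g_def)
    next
      case 0
      then show ?case
        using By by simp
    qed
    have y0: "y t = 0" if "t \<in> {0<..<1}" for t
      using assms[unfolded observable_def, rule_format, OF BNy[OF that, unfolded N_def]] .
    \<comment> \<open>Continuity carries \<open>y = 0\<close> back to time 0, where \<open>y\<close>
      equals \<open>v\<close>.\<close>
    have "continuous_on {0..1} y"
      using contY by (simp add: y_def)
    moreover have "y t = 0" if "t \<in> {0<..<1}" for t
      using y0[OF that] .
    ultimately have "y 0 = 0"
      using continuous_constant_on_closure[of "{0<..<1}" y 0 0] by simp
    then show "v = 0"
      using Y0 by (simp add: y_def)
  qed
  \<comment> \<open>\<open>G\<close> sends the initial costate to the state reached from rest; an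
    injective endomorphism in finite dimension is onto.\<close>
  define G where "G = (\<lambda>v. X 1 (0, v))"
  have linG: "linear G"
    unfolding G_def by (rule linear_compose[OF _ linX, unfolded o_def]) (auto intro: linearI)
  have "\<forall>v. G v = 0 \<longrightarrow> v = 0"
    using inj by (simp add: G_def)
  then have "inj G"
    unfolding linear_injective_0[OF linG] .
  then have "surj G"
    by (rule linear_injective_imp_surjective[OF linG _ refl])
  show ?thesis
    unfolding controllable_def
  proof (intro allI)
    fix x0 x1 :: "real ^ 'd"
    \<comment> \<open>The costate has to supply the difference between \<open>x1\<close> and the end
      point \<open>X 1 (x0, 0)\<close> of the free motion.\<close>
    obtain v where v: "G v = x1 - X 1 (x0, 0)"
      using \<open>surj G\<close> by (metis surjD)
    have "X 1 (x0, v) = X 1 ((x0, 0) + (0, v))"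
      by simp
    also have "\<dots> = x1"
      unfolding linear_add[OF linX] using v by (simp add: G_def)
    finally show "\<exists>T>0. \<exists>u x. trajectory A B T u x \<and> x 0 = x0 \<and> x T = x1"
      using traj[of "(x0, v)"] X0[of "(x0, v)"] by (intro exI[of _ 1]) auto
  qed
qed

section \<open>The Hautus test\<close>

text \<open>Take a nonzero polynomial \<open>p\<close> of least degree with
  \<open>p(N) x0 = 0\<close> and split off a root, \<open>p = (X - c) q\<close>. Then
  \<open>q(N) x0\<close> is nonzero by minimality, is annihilated by \<open>N - c\<close>, and stays
  in \<open>W\<close> by invariance.\<close>

lemma eigenvector_in_invariant_subspace:
  fixes N :: "complex ^ 'd \<Rightarrow> complex ^ 'd"
  assumes lin: "Vector_Spaces.linear (*s) (*s) N"
    and W: "vec.subspace W" "\<And>x. x \<in> W \<Longrightarrow> N x \<in> W"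
    and x0: "x0 \<in> W" "x0 \<noteq> 0"
  obtains y c where "y \<in> W" "y \<noteq> 0" "N y = c *s y"
proof -
  interpret N: Vector_Spaces.linear "(*s)" "(*s)" N
    by (fact lin)
  \<comment> \<open>\<open>H p\<close> is \<open>p(N) x0\<close>, evaluated by Horner's
    scheme.\<close>
  define H where "H p = fold_coeffs (\<lambda>a y. a *s x0 + N y) p 0" for p
  have H_0 [simp]: "H 0 = 0"
    by (simp add: H_def)
  have H_pCons [simp]: "H (pCons a p) = a *s x0 + N (H p)" for a p
  proof (cases "a = 0 \<and> p = 0")
    case True
    then show ?thesis
      by (simp add: N.zero)
  next
    case False
    then show ?thesis
      by (auto simp: H_def)
  qed
  have H_add: "H (p + q) = H p + H q" for p q
    by (induction p q rule: poly_induct2) (simp_all add: N.add vector_sadd_rdistrib)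
  have H_smult: "H (smult a p) = a *s H p" for a p
    by (induction p) (simp_all add: N.scale vector_add_ldistrib vector_smult_assoc)
  have H_W: "H p \<in> W" for p
    using W x0(1) by (induction p) (auto intro: vec.subspace_0 vec.subspace_add vec.subspace_scale)
  have H_monom: "H (monom a n) = a *s (N ^^ n) x0" for a n
    by (induction n) (simp_all add: monom_0 monom_Suc N.scale N.zero)
  have H_sum: "H (sum f I) = (\<Sum>i\<in>I. H (f i))" for f :: "nat \<Rightarrow> complex poly" and I
    by (induction I rule: infinite_finite_induct) (simp_all add: H_add)
  have "\<exists>p. p \<noteq> 0 \<and> H p = 0"
  proof -
    \<comment> \<open>One more iterate than the real dimension is taken. A repeated iterate is
      treated separately because linear dependence concerns the set of iterates, not the
      list.\<close>
    define g where "g n = (N ^^ n) x0" for n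
    define I where "I = {..DIM(complex ^ 'd)}"
    show ?thesis
    proof (cases "inj_on g I")
      case False
      then obtain m n where "m \<noteq> n" "g m = g n"
        by (auto simp: inj_on_def)
      define p :: "complex poly" where "p = monom 1 m + smult (-1) (monom 1 n)"
      have "coeff p m \<noteq> 0"
        using \<open>m \<noteq> n\<close> by (simp add: p_def)
      then have "p \<noteq> 0"
        by (metis coeff_0)
      moreover have "H p = 0"
        unfolding p_def H_add H_smult H_monom
        using \<open>g m = g n\<close> by (simp add: g_def vector_smult_lneg)
      ultimately show ?thesis
        by blast
    next
      case True
      then have "card (g ` I) > DIM(complex ^ 'd)"
        by (subst card_image) (simp_all add: I_def)
      then have "dependent (g ` I)"
        by (intro dependent_biggerset) auto
      then obtain u v where u: "v \<in> g ` I" "u v \<noteq> 0" "(\<Sum>v\<in>g ` I. u v *\<^sub>R v) = 0"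
        by (auto simp: dependent_finite I_def)
      define p where "p = (\<Sum>n\<in>I. monom (complex_of_real (u (g n))) n)"
      have "H p = (\<Sum>n\<in>I. u (g n) *\<^sub>R g n)"
        by (simp add: p_def H_sum H_monom g_def vec_eq_iff scaleR_conv_of_real[where 'a = complex])
      then have "H p = 0"
        using u(3) True by (simp add: sum.reindex)
      moreover have "p \<noteq> 0"
      proof -
        obtain n where n: "n \<in> I" "v = g n"
          using u(1) by blast
        then have "coeff p n = of_real (u v)"
          by (simp add: p_def coeff_sum I_def)
        then show ?thesis
          using u(2) by auto
      qed
      ultimately show ?thesis
        by blast
    qed
  qed
  then obtain p where p: "p \<noteq> 0" "H p = 0"
    and least: "\<And>q. q \<noteq> 0 \<Longrightarrow> H q = 0 \<Longrightarrow> degree p \<le> degree q"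
    using ex_has_least_nat[of "\<lambda>p. p \<noteq> 0 \<and> H p = 0" _ degree] by metis
  \<comment> \<open>A nonzero constant cannot annihilate \<open>x0\<close>, so the degree is
    positive and a root exists.\<close>
  have "degree p \<noteq> 0"
  proof
    assume "degree p = 0"
    then obtain a where "p = [:a:]"
      by (rule degree_eq_zeroE)
    then show False
      using p x0(2) by (simp add: N.zero)
  qed
  then obtain c where "poly p c = 0"
    using fundamental_theorem_of_algebra[of p] by (auto simp: constant_degree)
  then obtain q where q: "p = [:- c, 1:] * q"
    by (auto simp: poly_eq_0_iff_dvd)
  then have "q \<noteq> 0"
    using p(1) by auto
  then have "degree q < degree p"
    unfolding q by (subst degree_mult_eq) auto
  then have "H q \<noteq> 0"
    using least[of q] \<open>q \<noteq> 0\<close> by auto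
  moreover have "p = smult (- c) q + pCons 0 q"
    by (simp add: q)
  then have "H p = (- c) *s H q + N (H q)"
    by (simp only: H_add H_smult H_pCons) simp
  then have "N (H q) = c *s H q"
    using p(2) by (simp add: vector_smult_lneg)
  ultimately show thesis
    using H_W that by blast
qed

text \<open>The Hautus test: a nonzero unobservable vector makes the complex unobservable subspace
  nontrivial, and this invariant subspace then contains an eigenvector of the excluded kind.\<close>

lemma observableI_eigenvector:
  fixes A :: "real ^ 'd ^ 'd" and B :: "real ^ 'm ^ 'd"
  assumes no_eigenvector: "\<And>c x. \<forall>j. (\<Sum>i\<in>UNIV. of_real (A $ i $ j) * x i) = c * x j \<Longrightarrow>
      \<forall>k. (\<Sum>i\<in>UNIV. of_real (B $ i $ k) * x i) = (0 :: complex) \<Longrightarrow> \<forall>i. x i = 0"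
  shows "observable A B"
  unfolding observable_def
proof (intro allI impI)
  fix v :: "real ^ 'd"
  assume v: "\<forall>n. transpose B *v ((\<lambda>w. transpose A *v w) ^^ n) v = 0"
  define N :: "complex ^ 'd \<Rightarrow> complex ^ 'd" where
    "N x = (\<chi> j. \<Sum>i\<in>UNIV. of_real (A $ i $ j) * x $ i)" for x
  define x0 :: "complex ^ 'd" where "x0 = (\<chi> i. of_real (v $ i))"
  \<comment> \<open>The complex unobservable subspace; its condition at \<open>n = 0\<close> is what
    the eigenvector inherits.\<close>
  define W where "W = {x. \<forall>n k. (\<Sum>i\<in>UNIV. of_real (B $ i $ k) * (N ^^ n) x $ i) = 0}"
  have lin: "Vector_Spaces.linear (*s) (*s) N"
    by unfold_locales
       (auto simp: N_def vec_eq_iff algebra_simps sum.distrib sum_distrib_left)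
  interpret N: Vector_Spaces.linear "(*s)" "(*s)" N
    by (fact lin)
  have N_funpow: "(N ^^ n) 0 = 0" "(N ^^ n) (x + y) = (N ^^ n) x + (N ^^ n) y"
    "(N ^^ n) (c *s x) = c *s (N ^^ n) x" for n x y c
    by (induction n) (simp_all add: N.zero N.add N.scale)
  have sub: "vec.subspace W"
    unfolding vec.subspace_def W_def
    by (auto simp: N_funpow algebra_simps sum.distrib simp flip: sum_distrib_left)
  have inv: "N x \<in> W" if "x \<in> W" for x
  proof -
    have "(N ^^ n) (N x) = (N ^^ Suc n) x" for n
      by (simp only: funpow_Suc_right o_apply)
    then show ?thesis
      using that by (simp only: W_def mem_Collect_eq) blast
  qed
  have x0_funpow: "(N ^^ n) x0 = (\<chi> i. of_real (((\<lambda>w. transpose A *v w) ^^ n) v $ i))" for n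
  proof (induction n)
    case (Suc n)
    then show ?case
      by (simp add: N_def vec_eq_iff vector_matrix_mult_def mult.commute)
  qed (simp add: x0_def)
  have "x0 \<in> W"
    unfolding W_def
  proof (intro CollectI allI)
    fix n k
    have "(transpose B *v ((\<lambda>w. transpose A *v w) ^^ n) v) $ k = 0"
      using v by simp
    then have "of_real (\<Sum>i\<in>UNIV. B $ i $ k * ((\<lambda>w. transpose A *v w) ^^ n) v $ i) = (0 :: complex)"
      by (simp add: matrix_vector_mult_def transpose_def del: transpose_matrix_vector)
    then show "(\<Sum>i\<in>UNIV. of_real (B $ i $ k) * (N ^^ n) x0 $ i) = 0"
      unfolding x0_funpow by (simp del: transpose_matrix_vector)
  qed
  show "v = 0"
  proof (rule ccontr)
    assume "v \<noteq> 0"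
    then have "x0 \<noteq> 0"
      by (simp add: x0_def vec_eq_iff)
    then obtain y c where y: "y \<in> W" "y \<noteq> 0" "N y = c *s y"
      using eigenvector_in_invariant_subspace[OF lin sub inv \<open>x0 \<in> W\<close>] by blast
    have "\<forall>i. y $ i = 0"
    proof (rule no_eigenvector)
      show "\<forall>j. (\<Sum>i\<in>UNIV. of_real (A $ i $ j) * y $ i) = c * y $ j"
        using y(3) by (simp add: N_def vec_eq_iff)
      show "\<forall>k. (\<Sum>i\<in>UNIV. of_real (B $ i $ k) * y $ i) = 0"
        using y(1) by (auto simp: W_def dest: spec[of _ 0])
    qed
    then show False
      using y(2) by (simp add: vec_eq_iff)
  qed
qed


section \<open>Realizations built cycle by cycle\<close>

lemma orbit_permutation_induct:
  assumes "permutation f" "p \<in> orbit f e" "i \<in> orbit f e" "P p"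
    and "\<And>i. i \<in> orbit f e \<Longrightarrow> P i \<Longrightarrow> P (f i)"
  shows "P i"
proof -
  \<comment> \<open>A cycle is the orbit of each of its points, so the induction may start at
    \<open>p\<close> instead of \<open>e\<close>.\<close>
  have "i \<in> orbit f p"
    using assms(1-3) cyclic_on_orbit' orbit_cyclic_eq3 by metis
  then show ?thesis
  proof induction
    case base
    then show ?case
      using assms by blast
  next
    case (step y)
    then have "y \<in> orbit f e"
      using assms(2) orbit_trans by metis
    then show ?case
      using assms(5) step by blast
  qed
qed

lemma image_orbit:
  assumes "permutation f"
  shows "f ` orbit f e = orbit f e"
proof
  show "orbit f e \<subseteq> f ` orbit f e"
  proof
    fix y
    assume "y \<in> orbit f e"
    then show "y \<in> f ` orbit f e"
      by cases (auto simp: permutation_self_in_orbit[OF assms])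
  qed
qed (auto intro: orbit.step)

text \<open>Take norms and sum over the cycle: \<open>f\<close> permutes it, so the same total
  appears on both sides, once multiplied by \<open>norm c\<close> and once by
  \<open>r\<close>.\<close>

lemma cyclic_eigen_zero:
  fixes x :: "'a \<Rightarrow> complex" and c :: complex and r :: real
  assumes f: "permutation f" and "0 < r" "norm c \<noteq> r"
    and eq: "\<And>i. i \<in> orbit f e \<Longrightarrow> c * x (f i) = of_real r * x i"
    and "i \<in> orbit f e"
  shows "x i = 0"
proof -
  let ?O = "orbit f e"
  have fin: "finite ?O"
    using f by (intro finite_orbit permutation_self_in_orbit)
  have "bij_betw f ?O ?O"
    unfolding bij_betw_def image_orbit[OF f]
    using permutation_bijective[OF f] by (auto intro: inj_on_subset[OF bij_is_inj])
  then have "(\<Sum>i\<in>?O. norm (x i)) = (\<Sum>i\<in>?O. norm (x (f i)))"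
    by (rule sum.reindex_bij_betw[symmetric])
  moreover have "norm c * norm (x (f i)) = r * norm (x i)" if "i \<in> ?O" for i
    using arg_cong[OF eq[OF that], of norm] \<open>0 < r\<close> by (simp add: norm_mult)
  then have "norm c * (\<Sum>i\<in>?O. norm (x (f i))) = r * (\<Sum>i\<in>?O. norm (x i))"
    by (simp add: sum_distrib_left)
  ultimately have "(\<Sum>i\<in>?O. norm (x i)) = 0"
    using \<open>norm c \<noteq> r\<close> by simp
  then show ?thesis
    using fin \<open>i \<in> ?O\<close> by (simp add: sum_nonneg_eq_0_iff)
qed

text \<open>If \<open>x p\<close> were zero, zero would spread forward around the cycle and the
  equation entering \<open>p\<close> would read \<open>0 = s\<close>. So \<open>x p\<close> is
  nonzero, and this spreads forward because every step not entering \<open>p\<close> is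
  unforced.\<close>

lemma cyclic_forced_nonzero:
  fixes x :: "'a \<Rightarrow> complex" and c s :: complex and r :: real
  assumes f: "permutation f" and "r \<noteq> 0" "c \<noteq> 0" "s \<noteq> 0"
    and p: "p \<in> orbit f e"
    and eq: "\<And>i. i \<in> orbit f e \<Longrightarrow> c * x (f i) = of_real r * x i + (if f i = p then s else 0)"
    and i: "i \<in> orbit f e"
  shows "x i \<noteq> 0"
proof -
  have "x p \<noteq> 0"
  proof
    assume "x p = 0"
    have "x i = 0" if "i \<in> orbit f e" for i
    proof (rule orbit_permutation_induct[where P = "\<lambda>i. x i = 0", OF f p that \<open>x p = 0\<close>])
      show "x (f i) = 0" if "i \<in> orbit f e" "x i = 0" for i
        using eq[OF that(1)] that(2) \<open>x p = 0\<close> \<open>c \<noteq> 0\<close> by (cases "f i = p") auto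
    qed
    moreover have "p \<in> f ` orbit f e"
      using p by (simp only: image_orbit[OF f])
    then obtain i where "i \<in> orbit f e" "f i = p"
      by blast
    ultimately have "c * x p = of_real r * 0 + s"
      using eq[of i] by metis
    then show False
      using \<open>s \<noteq> 0\<close> \<open>x p = 0\<close> by simp
  qed
  show ?thesis
  proof (rule orbit_permutation_induct[where P = "\<lambda>i. x i \<noteq> 0", OF f p i \<open>x p \<noteq> 0\<close>])
    show "x (f i) \<noteq> 0" if "i \<in> orbit f e" "x i \<noteq> 0" for i
    proof (cases "f i = p")
      case False
      then have "c * x (f i) = of_real r * x i"
        using eq[OF that(1)] by simp
      then show ?thesis
        using that(2) \<open>r \<noteq> 0\<close> by (metis mult_eq_0_iff of_real_eq_0_iff)
    qed (simp add: \<open>x p \<noteq> 0\<close>)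
  qed
qed

text \<open>
  The columns of \<open>M = [A | B]\<close> are indexed by \<open>Inl\<close> of a state or \<open>Inr\<close> of an input, so a vanishing
  residual says that \<open>x\<close> is a left eigenvector of \<open>A\<close> annihilating \<open>B\<close>.
\<close>

definition residual ::
  "('d::finite \<Rightarrow> 'd + 'm \<Rightarrow> real) \<Rightarrow> complex \<Rightarrow> ('d \<Rightarrow> complex) \<Rightarrow> 'd + 'm \<Rightarrow> complex" where
  "residual M c x j =
     (case j of Inl l \<Rightarrow> c * x l | Inr _ \<Rightarrow> 0) - (\<Sum>i\<in>UNIV. of_real (M i j) * x i)"

text \<open>
  \<open>F\<close> contains the moduli already used. The last condition keeps the transfer function from the inputs
  to every column \<open>q\<close> nonzero away from \<open>F\<close>; this is what makes it possible to attach a new cycle at \<open>q\<close>.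
\<close>

definition partial_realization ::
  "('d::finite \<Rightarrow> 'd + 'm \<Rightarrow> bool) \<Rightarrow> 'd set \<Rightarrow> ('d \<Rightarrow> 'd + 'm \<Rightarrow> real) \<Rightarrow> real set \<Rightarrow> bool" where
  "partial_realization E X M F \<longleftrightarrow>
     (\<forall>i j. M i j \<noteq> 0 \<longrightarrow> i \<in> X \<and> j \<in> Inl ` X \<union> range Inr \<and> E i j) \<and>
     finite F \<and> 0 \<in> F \<and>
     (\<forall>c x. (\<forall>i. i \<notin> X \<longrightarrow> x i = 0) \<longrightarrow> (\<forall>j. residual M c x j = 0) \<longrightarrow> (\<forall>i. x i = 0)) \<and>
     (\<forall>c x s. \<forall>q \<in> Inl ` X \<union> range Inr. norm c \<notin> F \<longrightarrow> (\<forall>i. i \<notin> X \<longrightarrow> x i = 0) \<longrightarrow>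
        (\<forall>j. residual M c x j = (if j = q then s else 0)) \<longrightarrow> s = 0)"

lemma partial_realization_empty: "partial_realization E {} (\<lambda>_ _. 0) {0}"
  unfolding partial_realization_def
proof (intro conjI allI impI ballI)
  fix c x s and q :: "'a + 'b"
  assume "\<forall>i. i \<notin> {} \<longrightarrow> x i = 0" "\<forall>j. residual (\<lambda>_ _. 0) c x j = (if j = q then s else 0)"
  then have "residual (\<lambda>_ _. 0) c x q = s" "\<forall>i. x i = 0"
    by simp_all
  then show "s = 0"
    by (simp add: residual_def split: sum.splits)
qed auto

text \<open>The equations of the cycle do not involve the old states, and the old equations feel the
  cycle only through the value \<open>x e\<close> fed into column \<open>q\<close>. Everything
  therefore turns on \<open>x e = 0\<close>.\<close>

lemma partial_realization_add_cycle:
  assumes M: "partial_realization E X M F"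
    and f: "permutation f" and E_f: "\<And>i. E i (Inl (f i))"
    and X: "f ` X \<subseteq> X"
    and e: "e \<notin> X" and q: "q \<in> Inl ` X \<union> range Inr" and E_e: "E e q"
  shows "\<exists>M' F'. partial_realization E (X \<union> orbit f e) M' F'"
proof -
  let ?O = "orbit f e"
  note M_supp = M[unfolded partial_realization_def, THEN conjunct1, rule_format]
  have "finite F" "0 \<in> F"
    using M by (auto simp: partial_realization_def)
  have M_inj: "x i = 0" if "\<And>i. i \<notin> X \<Longrightarrow> x i = 0" "\<And>j. residual M c x j = 0" for c x i
    using M that unfolding partial_realization_def by blast
  have M_forced: "s = 0" if "p \<in> Inl ` X \<union> range Inr" "norm c \<notin> F" "\<And>i. i \<notin> X \<Longrightarrow> x i = 0"
    "\<And>j. residual M c x j = (if j = p then s else 0)" for p c x s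
    using M that unfolding partial_realization_def by blast
  \<comment> \<open>A radius outside \<open>F\<close> lets the old transfer condition be applied on
    the circle where the new eigenvalues lie.\<close>
  have "\<not> finite {0 :: real<..}"
    by (rule infinite_Ioi)
  then obtain r where "0 < r" "r \<notin> F"
    using \<open>finite F\<close> by (metis greaterThan_iff rev_finite_subset subsetI)
  have e_O: "e \<in> ?O"
    using f by (rule permutation_self_in_orbit)
  have f_O: "f i \<in> ?O \<longleftrightarrow> i \<in> ?O" for i
  proof
    assume "f i \<in> ?O"
    then have "f i \<in> f ` ?O"
      by (simp only: image_orbit[OF f])
    then obtain i' where "i' \<in> ?O" "f i' = f i"
      by force
    then show "i \<in> ?O"
      using permutation_bijective[OF f] by (metis bij_pointE)
  qed (rule orbit.step)
  \<comment> \<open>\<open>X\<close> is closed under \<open>f\<close>, so a cycle meeting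
    \<open>X\<close> would carry \<open>e\<close> into \<open>X\<close>.\<close>
  have disj: "i \<notin> X" if "i \<in> ?O" for i
  proof
    assume "i \<in> X"
    have "e \<in> X"
      by (rule orbit_permutation_induct[where P = "\<lambda>i. i \<in> X", OF f that e_O \<open>i \<in> X\<close>]) (use X in blast)
    then show False
      using e by blast
  qed
  define M' where "M' i j = M i j + (if i \<in> ?O \<and> j = Inl (f i) then r else 0) + (if i = e \<and> j = q then 1 else 0)" for i j
  have M_out: "M i j = 0" if "i \<notin> X" for i j
    using M_supp that by blast
  have q_O: "q \<noteq> Inl l" if "l \<in> ?O" for l
    using q disj[OF that] by auto
  \<comment> \<open>By injectivity of \<open>f\<close>, row \<open>i\<close> is the only nonzero row
    in this column; the unit edge lies elsewhere, since \<open>q\<close> is not a cycle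
    column.\<close>
  have res_O: "residual M' c x (Inl (f i)) = c * x (f i) - of_real r * x i" if "i \<in> ?O" for c x i
  proof -
    have "of_real (M' k (Inl (f i))) * x k = (if k = i then of_real r * x i else 0)" for k
    proof -
      have "f i \<in> ?O"
        using that f_O by blast
      then have "M k (Inl (f i)) = 0" "q \<noteq> Inl (f i)"
        using M_supp[of k "Inl (f i)"] disj q_O by auto
      moreover have "f i = f k \<longleftrightarrow> i = k"
        using permutation_bijective[OF f] by (metis bij_pointE)
      ultimately show ?thesis
        using that by (auto simp: M'_def)
    qed
    then show ?thesis
      by (simp add: residual_def)
  qed
  \<comment> \<open>Outside the cycle columns, the only entry of a cycle row is the 1 in row
    \<open>e\<close> at \<open>q\<close>. Restricting \<open>x\<close> to \<open>X\<close> thus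
    shifts the residual there by \<open>x e\<close> at \<open>q\<close> alone; on cycle columns the
    old matrix is zero.\<close>
  have res_X: "residual M c (\<lambda>i. if i \<in> X then x i else 0) j =
      (if j \<in> Inl ` ?O then 0 else residual M' c x j) + (if j = q then x e else 0)"
    if "\<And>i. i \<notin> X \<union> ?O \<Longrightarrow> x i = 0" for c x j
  proof (cases "j \<in> Inl ` ?O")
    case True
    then have "M k j = 0" "j \<noteq> q" for k
      using M_supp[of k j] disj q_O by auto
    then show ?thesis
      using True disj by (auto simp: residual_def)
  next
    case False
    have "(\<Sum>i\<in>UNIV. of_real (M' i j) * x i) =
        (\<Sum>i\<in>UNIV. of_real (M i j) * (if i \<in> X then x i else 0)) + (\<Sum>i\<in>UNIV. if i = e then (if j = q then x e else 0) else 0)"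
      unfolding sum.distrib[symmetric]
    proof (rule sum.cong[OF refl])
      fix i
      have "\<not> (i \<in> ?O \<and> j = Inl (f i))"
        using False f_O[of i] by blast
      then have M'_eq: "M' i j = M i j + (if i = e \<and> j = q then 1 else 0)"
        unfolding M'_def by (simp only: if_False add_0_right)
      show "of_real (M' i j) * x i =
          of_real (M i j) * (if i \<in> X then x i else 0) + (if i = e then (if j = q then x e else 0) else 0)"
      proof (cases "i = e")
        case True
        then show ?thesis
          using M_out[OF e, of j] e unfolding M'_eq by simp
      next
        case False
        then show ?thesis
          using M_out[of i j] unfolding M'_eq by simp
      qed
    qed
    moreover have "(case j of Inl l \<Rightarrow> c * (if l \<in> X then x l else 0) | Inr _ \<Rightarrow> 0) =
        (case j of Inl l \<Rightarrow> c * x l | Inr _ \<Rightarrow> 0)"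
      using False that by (auto split: sum.splits)
    ultimately show ?thesis
      using False by (simp add: residual_def)
  qed
  have "partial_realization E (X \<union> ?O) M' (insert r F)"
    unfolding partial_realization_def
  proof (intro conjI allI impI ballI)
    fix i j
    assume "M' i j \<noteq> 0"
    then consider "M i j \<noteq> 0" | "i \<in> ?O" "j = Inl (f i)" | "i = e" "j = q"
      by (auto simp: M'_def split: if_splits)
    then have "i \<in> X \<union> ?O \<and> j \<in> Inl ` (X \<union> ?O) \<union> range Inr \<and> E i j"
      using M_supp[of i j] f_O E_f E_e q e_O by cases auto
    then show "i \<in> X \<union> ?O" "j \<in> Inl ` (X \<union> ?O) \<union> range Inr" "E i j"
      by blast+
  next
    fix c x i
    assume supp: "\<forall>i. i \<notin> X \<union> ?O \<longrightarrow> x i = 0" and res: "\<forall>j. residual M' c x j = 0"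
    have cyc: "c * x (f i) = of_real r * x i" if "i \<in> ?O" for i
      using res_O[OF that, of c x] res by simp
    have resM: "residual M c (\<lambda>i. if i \<in> X then x i else 0) j = (if j = q then x e else 0)" for j
      using res_X supp res by simp
    \<comment> \<open>On the circle \<open>norm c = r\<close> the old part admits no nonzero forcing
      at \<open>q\<close>, since \<open>r\<close> is not in \<open>F\<close>; off that circle the
      cycle has only the zero solution.\<close>
    have "x e = 0"
    proof (cases "norm c = r")
      case True
      then show ?thesis
        using M_forced[OF q _ _ resM] \<open>r \<notin> F\<close> by simp
    next
      case False
      then show ?thesis
        using cyclic_eigen_zero[of f r c e x e] f \<open>0 < r\<close> False cyc e_O by blast
    qed
    have x_O: "x i = 0" if "i \<in> ?O" for i
    proof (rule orbit_permutation_induct[where P = "\<lambda>i. x i = 0", OF f e_O that \<open>x e = 0\<close>])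
      fix i assume i: "i \<in> ?O" "x i = 0"
      \<comment> \<open>For \<open>c = 0\<close> the forward step is lost, but the equation one
        position later reads \<open>r * x (f i) = 0\<close>.\<close>
      show "x (f i) = 0"
      proof (cases "c = 0")
        case True
        then show ?thesis
          using cyc[of "f i"] i f_O \<open>0 < r\<close> by simp
      next
        case False
        then show ?thesis
          using cyc[OF i(1)] i(2) by simp
      qed
    qed
    have "(if i \<in> X then x i else 0) = 0" for i
      by (rule M_inj[of _ c]) (use resM \<open>x e = 0\<close> in auto)
    then show "x i = 0"
      using x_O supp by (metis Un_iff)
  next
    fix c x s p
    assume p: "p \<in> Inl ` (X \<union> ?O) \<union> range Inr" and c: "norm c \<notin> insert r F"
      and supp: "\<forall>i. i \<notin> X \<union> ?O \<longrightarrow> x i = 0"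
      and res: "\<forall>j. residual M' c x j = (if j = p then s else 0)"
    have resM: "residual M c (\<lambda>i. if i \<in> X then x i else 0) j =
        (if j \<in> Inl ` ?O then 0 else if j = p then s else 0) + (if j = q then x e else 0)" for j
      using res_X supp res by simp
    \<comment> \<open>Forcing at a cycle column would make \<open>x e\<close> nonzero, while the old
      part makes it zero. Forcing elsewhere leaves the cycle homogeneous, so \<open>x e = 0\<close>
      and the old transfer condition applies.\<close>
    show "s = 0"
    proof (cases "p \<in> Inl ` ?O")
      case True
      then obtain l where l: "l \<in> ?O" "p = Inl l"
        by blast
      have "residual M c (\<lambda>i. if i \<in> X then x i else 0) j = (if j = q then x e else 0)" for j
        using resM True by auto
      then have "x e = 0"
        using M_forced[OF q, of c "\<lambda>i. if i \<in> X then x i else 0"] c by simp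
      have cyc: "c * x (f i) = of_real r * x i + (if f i = l then s else 0)" if "i \<in> ?O" for i
        using res_O[OF that, of c x] res l by simp
      show ?thesis
      proof (rule ccontr)
        assume "s \<noteq> 0"
        \<comment> \<open>\<open>F\<close> contains 0 for this purpose: away from \<open>F\<close>,
          \<open>c\<close> can be divided by.\<close>
        have "r \<noteq> 0" "c \<noteq> 0"
          using \<open>0 < r\<close> c \<open>0 \<in> F\<close> by auto
        then have "x e \<noteq> 0"
          using cyclic_forced_nonzero[of f r c s l e x e] f \<open>s \<noteq> 0\<close> l(1) cyc e_O by blast
        then show False
          using \<open>x e = 0\<close> by blast
      qed
    next
      case False
      have cyc: "c * x (f i) = of_real r * x i" if "i \<in> ?O" for i
      proof -
        have "Inl (f i) \<noteq> p"
          using False that f_O[of i] by blast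
        then show ?thesis
          using res_O[OF that, of c x] res by simp
      qed
      have "x e = 0"
        using cyclic_eigen_zero[of f r c e x e] f \<open>0 < r\<close> cyc e_O c by blast
      then have "residual M c (\<lambda>i. if i \<in> X then x i else 0) j = (if j = p then s else 0)" for j
        using resM False by auto
      moreover have "p \<in> Inl ` X \<union> range Inr"
        using p False by auto
      ultimately show ?thesis
        using M_forced[of p c "\<lambda>i. if i \<in> X then x i else 0"] c by simp
    qed
  qed (use \<open>finite F\<close> \<open>0 \<in> F\<close> in auto)
  then show ?thesis
    by blast
qed

text \<open>As long as states are missing, \<open>cut\<close> offers an edge into one of them from
  the part built so far or from an input, and its whole cycle is added. \<open>X\<close> stays a
  union of cycles and its complement shrinks.\<close>

lemma partial_realization_UNIV:
  fixes E :: "'d::finite \<Rightarrow> 'd + 'm \<Rightarrow> bool"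
  assumes f: "permutation f" and E_f: "\<And>i. E i (Inl (f i))"
    and cut: "\<And>X. X \<noteq> UNIV \<Longrightarrow> \<exists>e. e \<notin> X \<and> (\<exists>q \<in> Inl ` X \<union> range Inr. E e q)"
  shows "\<exists>M F. partial_realization E UNIV M F"
proof -
  have "\<exists>M F. partial_realization E UNIV M F"
    if "f ` X \<subseteq> X" "partial_realization E X M F" for X M F
    using that
  proof (induction "card (- X)" arbitrary: X M F rule: less_induct)
    case less
    show ?case
    proof (cases "X = UNIV")
      case True
      then show ?thesis
        using less.prems by blast
    next
      case False
      then obtain e q where e: "e \<notin> X" "q \<in> Inl ` X \<union> range Inr" "E e q"
        using cut by blast
      obtain M' F' where "partial_realization E (X \<union> orbit f e) M' F'"
        using partial_realization_add_cycle[OF less.prems(2) f E_f less.prems(1) e] by blast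
      moreover have "f ` (X \<union> orbit f e) \<subseteq> X \<union> orbit f e"
        using less.prems(1) by (auto intro: orbit.step)
      moreover have "card (- (X \<union> orbit f e)) < card (- X)"
        using e(1) permutation_self_in_orbit[OF f, of e] by (intro psubset_card_mono) auto
      ultimately show ?thesis
        using less.hyps by blast
    qed
  qed
  from this[OF _ partial_realization_empty] show ?thesis
    by simp
qed

text \<open>\<open>cut\<close> says that every state is reachable from an input, phrased over cuts
  because growing \<open>X\<close> consumes it in this form; the case \<open>X = {}\<close> demands
  an input entry.\<close>

lemma structurally_controllableI:
  fixes A :: "entry ^ 'd ^ 'd" and B :: "entry ^ 'm ^ 'd"
  assumes f: "bij f" and A_f: "\<And>i. A $ i $ f i \<noteq> Fixed_Zero"
    and cut: "\<And>X. X \<noteq> UNIV \<Longrightarrow>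
      \<exists>e. e \<notin> X \<and> ((\<exists>l \<in> X. A $ e $ l \<noteq> Fixed_Zero) \<or> (\<exists>k. B $ e $ k \<noteq> Fixed_Zero))"
  shows "structurally_controllable A B"
proof -
  define E where "E i j \<longleftrightarrow> (case j of Inl l \<Rightarrow> A $ i $ l | Inr k \<Rightarrow> B $ i $ k) \<noteq> Fixed_Zero" for i j
  have perm: "permutation f"
    using f by (auto simp: permutation)
  have "\<exists>M F. partial_realization E UNIV M F"
  proof (rule partial_realization_UNIV[OF perm])
    show "\<exists>e. e \<notin> X \<and> (\<exists>q \<in> Inl ` X \<union> range Inr. E e q)" if "X \<noteq> UNIV" for X
      using cut[OF that] by (force simp: E_def)
  qed (simp add: E_def A_f)
  then obtain M F where M: "partial_realization E UNIV M F"
    by blast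
  define A' :: "real ^ 'd ^ 'd" where "A' = (\<chi> i j. M i (Inl j))"
  define B' :: "real ^ 'm ^ 'd" where "B' = (\<chi> i k. M i (Inr k))"
  have supp: "E i j" if "M i j \<noteq> 0" for i j
    using M that by (auto simp: partial_realization_def)
  have "realization A' A" "realization B' B"
    using supp by (force simp: realization_def A'_def B'_def E_def)+
  moreover have "observable A' B'"
  proof (rule observableI_eigenvector)
    fix c and x :: "'d \<Rightarrow> complex"
    assume "\<forall>j. (\<Sum>i\<in>UNIV. of_real (A' $ i $ j) * x i) = c * x j"
      and "\<forall>k. (\<Sum>i\<in>UNIV. of_real (B' $ i $ k) * x i) = 0"
    then have "residual M c x j = 0" for j
      by (simp add: residual_def A'_def B'_def split: sum.splits)
    then show "\<forall>i. x i = 0"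
      using M unfolding partial_realization_def by blast
  qed
  ultimately show ?thesis
    unfolding structurally_controllable_def using observable_imp_controllable by blast
qed

section \<open>Necessity of an input in every source component\<close>

text \<open>The coordinates in \<open>S\<close> obey a homogeneous linear system of their own.
  Started at zero they stay there by Gronwall, so the all-ones state is out of reach.\<close>

lemma not_controllable_if_uninfluenced:
  fixes A :: "real ^ 'd ^ 'd" and B :: "real ^ 'm ^ 'd"
  assumes "S \<noteq> {}"
    and A: "\<And>i j. i \<in> S \<Longrightarrow> j \<notin> S \<Longrightarrow> A $ i $ j = 0"
    and B: "\<And>i k. i \<in> S \<Longrightarrow> B $ i $ k = 0"
  shows "\<not> controllable A B"
proof
  assume "controllable A B"
  then obtain T u x where "0 < T" and traj: "trajectory A B T u x" and x0: "x 0 = 0" and xT: "x T = (\<chi> i. 1)"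
    unfolding controllable_def by metis
  define g where "g i t = (\<Sum>j\<in>S. A $ i $ j * x t $ j)" for i t
  have int: "(g i has_integral x t $ i) {0..t}" if "i \<in> S" "t \<in> {0..T}" for i t
  proof -
    have "((\<lambda>s. (A *v x s + B *v u s) $ i) has_integral (x t - x 0) $ i) {0..t}"
      using traj that(2) has_integral_linear[OF _ bounded_linear_vec_nth[of i]]
      unfolding trajectory_def o_def by blast
    moreover have "(A *v x s + B *v u s) $ i = g i s" for s
    proof -
      have "(\<Sum>j\<in>UNIV. A $ i $ j * x s $ j) = g i s"
        unfolding g_def by (rule sum.mono_neutral_right) (use A that(1) in auto)
      then show ?thesis
        using B that(1) by (simp add: matrix_vector_mult_def)
    qed
    ultimately show ?thesis
      using x0 by simp
  qed
  have x_eq: "x t $ i = integral {0..t} (g i)" if "i \<in> S" "t \<in> {0..T}" for i t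
    using int[OF that] by (rule integral_unique[symmetric])
  \<comment> \<open>The equation holds only in integrated form, so regularity is gained in stages:
    an indefinite integral is continuous, hence \<open>g i\<close> is, hence these coordinates are
    differentiable inside the interval.\<close>
  have contx: "continuous_on {0..T} (\<lambda>t. x t $ i)" if "i \<in> S" for i
  proof -
    have "continuous_on {0..T} (\<lambda>t. integral {0..t} (g i))"
      using int[OF that, of T] \<open>0 < T\<close> by (intro indefinite_integral_continuous_1) (auto simp: integrable_on_def)
    then show ?thesis
      by (rule continuous_on_eq) (simp add: x_eq[OF that])
  qed
  have contg: "continuous_on {0..T} (g i)" for i
    unfolding g_def by (intro continuous_intros contx)
  have dx: "((\<lambda>t. x t $ i) has_real_derivative g i t) (at t)" if "i \<in> S" "0 < t" "t < T" for i t
  proof -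
    have "((\<lambda>t. integral {0..t} (g i)) has_real_derivative g i t) (at t within {0..T})"
      using that by (intro integral_has_real_derivative contg) auto
    then have "((\<lambda>t. integral {0..t} (g i)) has_real_derivative g i t) (at t)"
      using that by (simp add: at_within_Icc_at)
    then show ?thesis
    proof (rule has_field_derivative_transform_within_open)
      show "integral {0..s} (g i) = x s $ i" if "s \<in> {0<..<T}" for s
        using x_eq[OF \<open>i \<in> S\<close>, of s] that by simp
    qed (use that in auto)
  qed
  \<comment> \<open>Each product of two coordinates in \<open>S\<close> is at most
    \<open>n t\<close> in modulus, so this \<open>K\<close> gives
    \<open>n' \<le> 2 K n\<close>.\<close>
  define K where "K = (\<Sum>i\<in>S. \<Sum>j\<in>S. \<bar>A $ i $ j\<bar>)"
  define n where "n t = (\<Sum>i\<in>S. (x t $ i)\<^sup>2)" for t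
  have sq: "(x t $ i)\<^sup>2 \<le> n t" if "i \<in> S" for i t
    unfolding n_def by (rule member_le_sum) (use that in auto)
  have growth: "(\<Sum>i\<in>S. x t $ i * g i t) \<le> K * n t" for t
  proof -
    have "(\<Sum>i\<in>S. x t $ i * g i t) = (\<Sum>i\<in>S. \<Sum>j\<in>S. A $ i $ j * (x t $ i * x t $ j))"
      by (simp add: g_def sum_distrib_left mult.left_commute)
    also have "\<dots> \<le> (\<Sum>i\<in>S. \<Sum>j\<in>S. \<bar>A $ i $ j\<bar> * n t)"
    proof (intro sum_mono)
      fix i j assume "i \<in> S" "j \<in> S"
      have "2 * \<bar>x t $ i * x t $ j\<bar> \<le> (x t $ i)\<^sup>2 + (x t $ j)\<^sup>2"
        using sum_squares_bound[of "\<bar>x t $ i\<bar>" "\<bar>x t $ j\<bar>"] by (simp add: abs_mult)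
      then have "\<bar>x t $ i * x t $ j\<bar> \<le> n t"
        using sq[OF \<open>i \<in> S\<close>, of t] sq[OF \<open>j \<in> S\<close>, of t] by linarith
      then have "\<bar>A $ i $ j\<bar> * \<bar>x t $ i * x t $ j\<bar> \<le> \<bar>A $ i $ j\<bar> * n t"
        by (rule mult_left_mono) simp
      then show "A $ i $ j * (x t $ i * x t $ j) \<le> \<bar>A $ i $ j\<bar> * n t"
        using abs_ge_self[of "A $ i $ j * (x t $ i * x t $ j)"] unfolding abs_mult by linarith
    qed
    also have "\<dots> = K * n t"
      by (simp add: K_def sum_distrib_right)
    finally show ?thesis .
  qed
  \<comment> \<open>The integrating factor turns the growth bound on \<open>n\<close> into
    monotonicity.\<close>
  define \<phi> where "\<phi> t = exp (- 2 * K * t) * n t" for t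
  have "\<phi> T \<le> \<phi> 0"
  proof (rule DERIV_nonpos_imp_decreasing_open[of 0 T \<phi>])
    fix t assume t: "0 < t" "t < T"
    have dn: "(n has_real_derivative 2 * (\<Sum>i\<in>S. x t $ i * g i t)) (at t)"
      unfolding n_def sum_distrib_left
      by (rule DERIV_sum, rule derivative_eq_intros, rule dx) (use t in auto)
    have "(\<phi> has_real_derivative exp (- 2 * K * t) * (2 * (\<Sum>i\<in>S. x t $ i * g i t) - 2 * K * n t)) (at t)"
      unfolding \<phi>_def by (auto intro!: derivative_eq_intros dn simp: algebra_simps)
    moreover have "exp (- 2 * K * t) * (2 * (\<Sum>i\<in>S. x t $ i * g i t) - 2 * K * n t) \<le> 0"
      using growth[of t] by (intro mult_nonneg_nonpos) auto
    ultimately show "\<exists>y. (\<phi> has_real_derivative y) (at t) \<and> y \<le> 0"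
      by blast
  next
    show "continuous_on {0..T} \<phi>"
      unfolding \<phi>_def n_def by (intro continuous_intros contx)
  qed (use \<open>0 < T\<close> in auto)
  moreover have "\<phi> 0 = 0"
    by (simp add: \<phi>_def n_def x0)
  moreover have "\<phi> T > 0"
    using \<open>S \<noteq> {}\<close> by (simp add: \<phi>_def n_def xT card_gt_0_iff)
  ultimately show False
    by simp
qed

section \<open>Perfect matchings as permutations\<close>

lemma perfect_matching_permutation:
  fixes A :: "entry ^ 'd ^ 'd"
  assumes "has_perfect_matching UNIV (bipartite_edges A)"
  obtains f where "bij f" "\<And>i. A $ i $ f i \<noteq> Fixed_Zero"
proof -
  obtain M where "matching (bipartite_edges A) M" and sat: "\<forall>v\<in>UNIV. \<exists>e\<in>M. v \<in> e"
    using assms unfolding has_perfect_matching_def by blast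
  then have M: "M \<subseteq> bipartite_edges A" "\<And>e f. e \<in> M \<Longrightarrow> f \<in> M \<Longrightarrow> e \<noteq> f \<Longrightarrow> e \<inter> f = {}"
    by (simp_all add: matching_def)
  have "\<exists>j. {Inl j, Inr i} \<in> M \<and> A $ i $ j \<noteq> Fixed_Zero" for i
  proof -
    obtain e where e: "e \<in> M" "Inr i \<in> e"
      using sat by blast
    then obtain i' j where "e = {Inl j, Inr i'}" "A $ i' $ j \<noteq> Fixed_Zero"
      using M(1) unfolding bipartite_edges_def by blast
    moreover from this have "i' = i"
      using e(2) by simp
    ultimately show ?thesis
      using e(1) by blast
  qed
  \<comment> \<open>\<open>f i\<close> is the column matched to row \<open>i\<close>, so
    \<open>f\<close> runs against the digraph: the edge goes from \<open>f i\<close> to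
    \<open>i\<close>.\<close>
  then obtain f where f: "\<And>i. {Inl (f i), Inr i} \<in> M" "\<And>i. A $ i $ f i \<noteq> Fixed_Zero"
    by metis
  \<comment> \<open>Two matching edges sharing the endpoint \<open>Inl (f i)\<close> must
    coincide.\<close>
  have "inj f"
  proof (rule injI)
    fix i i' assume "f i = f i'"
    then have "{Inl (f i), Inr i} \<inter> {Inl (f i'), Inr i'} \<noteq> {}"
      by simp
    then have "{Inl (f i), Inr i} = {Inl (f i'), Inr i'}"
      using M(2)[OF f(1)[of i] f(1)[of i']] by argo
    then show "i = i'"
      by (simp add: doubleton_eq_iff)
  qed
  then have "bij f"
    using finite_UNIV_inj_surj[of f] by (simp add: bij_def)
  then show thesis
    using f(2) that by blast
qed

section \<open>Source components and reachability in the state digraph\<close>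

lemma fin_digraph_state_digraph: "fin_digraph (state_digraph A)"
  by unfold_locales (auto simp: state_digraph_def)

context wf_digraph
begin

lemma source_sccs_verts: "S \<in> source_sccs G \<Longrightarrow> verts S \<in> sccs_verts"
  by (auto simp: source_sccs_def sccs_verts_conv)

lemma source_sccs_closed:
  assumes S: "S \<in> source_sccs G" and e: "e \<in> arcs G" "head G e \<in> verts S"
  shows "tail G e \<in> verts S"
proof -
  have "scc_of (tail G e) \<in> sccs_verts"
    using e(1) by (intro scc_of_in_sccs_verts tail_in_verts)
  then have S': "G \<restriction> scc_of (tail G e) \<in> sccs"
    by (simp add: in_sccs_verts_conv)
  have "tail G e \<in> verts (G \<restriction> scc_of (tail G e))"
    using e(1) by (simp add: in_scc_of_self)
  then show ?thesis
    using S S' e unfolding source_sccs_def by auto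
qed

text \<open>Among the vertices reaching \<open>v\<close>, take \<open>u\<close> with the fewest
  ancestors. Whatever reaches \<open>u\<close> has the same ancestors by minimality and so is
  reached back from \<open>u\<close>; hence no edge enters the component of \<open>u\<close> from
  another one.\<close>

lemma source_scc_reaching:
  assumes "finite (verts G)" "v \<in> verts G"
  obtains S u where "S \<in> source_sccs G" "u \<in> verts S" "u \<rightarrow>\<^sup>* v"
proof -
  define P where "P u = {w. w \<rightarrow>\<^sup>* u}" for u
  have fin: "finite (P u)" for u
    by (rule finite_subset[OF _ assms(1)]) (auto simp: P_def reachable_in_verts)
  have "v \<rightarrow>\<^sup>* v"
    using assms(2) by simp
  then obtain u where u: "u \<rightarrow>\<^sup>* v" and least: "\<And>w. w \<rightarrow>\<^sup>* v \<Longrightarrow> card (P u) \<le> card (P w)"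
    using ex_has_least_nat[of "\<lambda>u. u \<rightarrow>\<^sup>* v" v "\<lambda>u. card (P u)"] by blast
  have returns: "u \<rightarrow>\<^sup>* w" if "w \<rightarrow>\<^sup>* u" for w
  proof -
    have "P w \<subseteq> P u"
      using that by (auto simp: P_def intro: reachable_trans)
    moreover have "card (P u) \<le> card (P w)"
      using least that u reachable_trans by blast
    ultimately have "P w = P u"
      using fin by (metis card_seteq)
    moreover have "u \<in> P u"
      using u by (simp add: P_def reachable_in_verts)
    ultimately show ?thesis
      unfolding P_def by blast
  qed
  have u_in: "u \<in> verts G"
    using u by (rule reachable_in_verts)
  let ?S = "G \<restriction> scc_of u"
  have scc: "scc_of u \<in> sccs_verts"
    using u_in by (rule scc_of_in_sccs_verts)
  have "?S \<in> source_sccs G"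
    unfolding source_sccs_def
  proof (intro CollectI conjI notI)
    show "?S \<in> sccs"
      using scc by (simp add: in_sccs_verts_conv)
    assume "\<exists>S'\<in>sccs. S' \<noteq> ?S \<and> (\<exists>e\<in>arcs G. tail G e \<in> verts S' \<and> head G e \<in> verts ?S)"
    then obtain S' e where S': "S' \<in> sccs" "S' \<noteq> ?S" and e: "e \<in> arcs G" "tail G e \<in> verts S'" "head G e \<in> verts ?S"
      by blast
    have "tail G e \<rightarrow>\<^sup>* head G e"
      using e(1) by (intro reachable_adjI) (auto simp: arcs_ends_def arc_to_ends_def)
    moreover have "head G e \<rightarrow>\<^sup>* u"
      using e(3) by (simp add: scc_of_def)
    ultimately have "tail G e \<rightarrow>\<^sup>* u"
      by (rule reachable_trans)
    then have "tail G e \<in> scc_of u"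
      using returns by (simp add: scc_of_def)
    moreover have "verts S' \<in> sccs_verts"
      using S'(1) by (simp add: sccs_verts_conv)
    ultimately have "verts S' = verts ?S"
      using scc e(2) sccs_verts_disjoint by fastforce
    then show False
      using S' \<open>?S \<in> sccs\<close> inj_on_verts_sccs unfolding inj_on_def by blast
  qed
  moreover have "u \<in> verts ?S"
    using u_in by (simp add: in_scc_of_self)
  ultimately show thesis
    using u that by blast
qed

end

lemma state_digraph_reachable_cut:
  fixes A :: "entry ^ 'd ^ 'd"
  assumes "u \<rightarrow>\<^sup>*\<^bsub>state_digraph A\<^esub> v" "u \<in> X" "v \<notin> X"
  obtains e l where "e \<notin> X" "l \<in> X" "A $ e $ l \<noteq> Fixed_Zero"
proof -
  interpret fin_digraph "state_digraph A"
    by (rule fin_digraph_state_digraph)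
  have "v \<notin> X \<longrightarrow> (\<exists>e l. e \<notin> X \<and> l \<in> X \<and> A $ e $ l \<noteq> Fixed_Zero)"
    using assms(1)
  proof (induction rule: reachable_induct)
    case base
    then show ?case
      using assms(2) by blast
  next
    case (step x y)
    from step(2) have "A $ y $ x \<noteq> Fixed_Zero"
      by (auto simp: state_digraph_def arcs_ends_def arc_to_ends_def)
    then show ?case
      using step by blast
  qed
  then show thesis
    using assms(3) that by blast
qed

text \<open>No edge enters the component, so its rows of \<open>A\<close> vanish outside it. Without
  an input entry, every realization would leave this block uninfluenced.\<close>

lemma source_scc_has_input:
  fixes A :: "entry ^ 'd ^ 'd" and B :: "entry ^ 'm ^ 'd"
  assumes "structurally_controllable A B" and S: "S \<in> source_sccs (state_digraph A)"
  shows "\<exists>i \<in> verts S. \<exists>k. B $ i $ k \<noteq> Fixed_Zero"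
proof (rule ccontr)
  interpret fin_digraph "state_digraph A"
    by (rule fin_digraph_state_digraph)
  assume none: "\<not> ?thesis"
  obtain A' B' where A': "realization A' A" and B': "realization B' B" and "controllable A' B'"
    using assms(1) unfolding structurally_controllable_def by blast
  moreover have "\<not> controllable A' B'"
  proof (rule not_controllable_if_uninfluenced)
    show "verts S \<noteq> {}"
      using source_sccs_verts[OF S] by (simp add: in_sccs_verts_conv_reachable)
    show "A' $ i $ j = 0" if "i \<in> verts S" "j \<notin> verts S" for i j
    proof -
      have "A $ i $ j = Fixed_Zero"
        using source_sccs_closed[OF S, of "(j, i)"] that by (auto simp: state_digraph_def)
      then show ?thesis
        using A' by (simp add: realization_def)
    qed
    show "B' $ i $ k = 0" if "i \<in> verts S" for i k
      using none that B' by (auto simp: realization_def)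
  qed
  ultimately show False
    by blast
qed

section \<open>Optimality of the selection\<close>

theorem proposition4p4:
  fixes A :: "entry ^ 'd ^ 'd"
    and B Bs :: "entry ^ 'm ^ 'd"
    and w :: "real ^ 'm ^ 'd"
  assumes "structurally_controllable A B"
    and "\<And>i j. B $ i $ j \<noteq> Fixed_Zero \<Longrightarrow> w $ i $ j \<ge> 0"
    and "has_perfect_matching UNIV (bipartite_edges A)"
    and "sscc_algorithm_output A B w Bs"
  shows "Bs \<in> feasible A B \<and> (\<forall>B' \<in> feasible A B. weighted_norm w Bs \<le> weighted_norm w B')"
proof -
  let ?SS = "source_sccs (state_digraph A)"
  interpret fin_digraph "state_digraph A"
    by (rule fin_digraph_state_digraph)
  obtain k l where
    sel: "\<forall>S \<in> ?SS. (\<forall>i \<in> verts S. is_arg_min (extended_cost B w i) (\<lambda>_. True) (k i)) \<and>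
      is_arg_min (\<lambda>i. extended_cost B w i (k i)) (\<lambda>i. i \<in> verts S) (l S)"
    and Bs: "Bs = (\<chi> i j. if (j, i) \<in> {(k (l S), l S) | S. S \<in> ?SS} then Star else Fixed_Zero)"
    using assms(4) unfolding sscc_algorithm_output_def sscc_selection_def by blast
  have k: "extended_cost B w i (k i) \<le> extended_cost B w i j" if "S \<in> ?SS" "i \<in> verts S" for S i j
    using sel that by (simp add: is_arg_min_linorder)
  have l: "l S \<in> verts S" if "S \<in> ?SS" for S
    using sel that by (simp add: is_arg_min_linorder)
  have l_min: "extended_cost B w (l S) (k (l S)) \<le> extended_cost B w i (k i)"
    if "S \<in> ?SS" "i \<in> verts S" for S i
    using sel that by (simp add: is_arg_min_linorder)
  \<comment> \<open>The selected pairs are turned into row-first order to match matrix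
    indices.\<close>
  define p where "p S = (l S, k (l S))" for S
  have Bs_supp: "Bs $ i $ j \<noteq> Fixed_Zero \<longleftrightarrow> (i, j) \<in> p ` ?SS" for i j
    by (auto simp: Bs p_def)
  \<comment> \<open>Any available entry in the component has finite extended cost, so the selected
    minimum is finite too and lies on the support of \<open>B\<close>.\<close>
  have cheapest: "B $ l S $ k (l S) \<noteq> Fixed_Zero \<and> w $ l S $ k (l S) \<le> w $ i $ j"
    if "S \<in> ?SS" "i \<in> verts S" "B $ i $ j \<noteq> Fixed_Zero" for S i j
  proof -
    have "extended_cost B w (l S) (k (l S)) \<le> extended_cost B w i j"
      using l_min[OF that(1,2)] k[OF that(1,2)] by (rule order_trans)
    then show ?thesis
      using that(3) by (auto simp: extended_cost_def split: if_splits)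
  qed
  have B_l: "B $ l S $ k (l S) \<noteq> Fixed_Zero" if "S \<in> ?SS" for S
    using source_scc_has_input[OF assms(1) that] cheapest[OF that] by blast
  have "structurally_controllable A Bs"
  proof -
    obtain f where f: "bij f" "\<And>i. A $ i $ f i \<noteq> Fixed_Zero"
      using perfect_matching_permutation[OF assms(3)] by blast
    show ?thesis
      using f
    proof (rule structurally_controllableI)
      fix X :: "'d set"
      assume "X \<noteq> UNIV"
      then obtain v where v: "v \<notin> X"
        by blast
      \<comment> \<open>Some source component reaches \<open>v\<close>, and \<open>l S\<close>
        reaches all of that component. Either the walk from \<open>l S\<close> to \<open>v\<close>
        leaves \<open>X\<close>, or \<open>l S\<close> is outside \<open>X\<close> and has its
        selected input.\<close>
      obtain S u where S: "S \<in> ?SS" "u \<in> verts S" "u \<rightarrow>\<^sup>*\<^bsub>state_digraph A\<^esub> v"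
        by (rule source_scc_reaching[of v]) (auto simp: state_digraph_def)
      have "l S \<rightarrow>\<^sup>*\<^bsub>state_digraph A\<^esub> u"
        using source_sccs_verts[OF S(1)] l[OF S(1)] S(2) by (auto simp: in_sccs_verts_conv_reachable)
      then have reach: "l S \<rightarrow>\<^sup>*\<^bsub>state_digraph A\<^esub> v"
        using S(3) by (rule reachable_trans)
      show "\<exists>e. e \<notin> X \<and> ((\<exists>l \<in> X. A $ e $ l \<noteq> Fixed_Zero) \<or> (\<exists>k. Bs $ e $ k \<noteq> Fixed_Zero))"
      proof (cases "l S \<in> X")
        case True
        then show ?thesis
          using state_digraph_reachable_cut[OF reach True v] by blast
      next
        case False
        have "Bs $ l S $ k (l S) \<noteq> Fixed_Zero"
          using S(1) by (auto simp: Bs_supp p_def)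
        then show ?thesis
          using False by blast
      qed
    qed
  qed
  moreover have "zeros B \<subseteq> zeros Bs"
  proof -
    have "B $ i $ j \<noteq> Fixed_Zero" if "Bs $ i $ j \<noteq> Fixed_Zero" for i j
      using that B_l unfolding Bs_supp p_def by blast
    then show ?thesis
      unfolding zeros_def by blast
  qed
  ultimately have "Bs \<in> feasible A B"
    by (simp add: feasible_def)
  moreover have "weighted_norm w Bs \<le> weighted_norm w B'" if B': "B' \<in> feasible A B" for B'
  proof -
    have sub: "B $ i $ j \<noteq> Fixed_Zero" if "B' $ i $ j \<noteq> Fixed_Zero" for i j
      using B' that unfolding feasible_def zeros_def by blast
    \<comment> \<open>Every competitor also pays for at least one entry in each source component;
      one such entry is fixed per component.\<close>
    have "\<exists>q. fst q \<in> verts S \<and> B' $ fst q $ snd q \<noteq> Fixed_Zero" if "S \<in> ?SS" for S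
      using source_scc_has_input[OF _ that, of B'] B' by (auto simp: feasible_def)
    then obtain q where q: "\<And>S. S \<in> ?SS \<Longrightarrow> fst (q S) \<in> verts S"
      "\<And>S. S \<in> ?SS \<Longrightarrow> B' $ fst (q S) $ snd (q S) \<noteq> Fixed_Zero"
      by metis
    \<comment> \<open>Components are disjoint, so neither \<open>p\<close> nor \<open>q\<close>
      counts an entry twice.\<close>
    have eq: "S = S'" if "S \<in> ?SS" "S' \<in> ?SS" "i \<in> verts S" "i \<in> verts S'" for S S' i
    proof -
      have "verts S = verts S'"
        using sccs_verts_disjoint[OF source_sccs_verts source_sccs_verts, OF that(1,2)] that(3,4) by blast
      then show ?thesis
        using that(1,2) inj_on_verts_sccs by (auto simp: source_sccs_def dest: inj_onD)
    qed
    have inj_p: "inj_on p ?SS" and inj_q: "inj_on q ?SS"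
      using eq l q(1) by (metis inj_onI p_def fst_conv)+
    have "weighted_norm w Bs = (\<Sum>(i, j)\<in>p ` ?SS. w $ i $ j)"
      unfolding weighted_norm_def Bs_supp by simp
    also have "\<dots> = (\<Sum>S\<in>?SS. w $ l S $ k (l S))"
      unfolding sum.reindex[OF inj_p] by (simp add: p_def)
    also have "\<dots> \<le> (\<Sum>S\<in>?SS. w $ fst (q S) $ snd (q S))"
      using cheapest q sub by (intro sum_mono) blast
    also have "\<dots> = (\<Sum>(i, j)\<in>q ` ?SS. w $ i $ j)"
      by (simp add: sum.reindex[OF inj_q] case_prod_unfold)
    \<comment> \<open>The remaining entries of \<open>B'\<close> lie on the support of
      \<open>B\<close>, where costs are nonnegative.\<close>
    also have "\<dots> \<le> weighted_norm w B'"
      unfolding weighted_norm_def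
    proof (rule sum_mono2)
      show "q ` ?SS \<subseteq> {(i, j). B' $ i $ j \<noteq> Fixed_Zero}"
        using q(2) by (simp add: image_subset_iff case_prod_unfold)
    qed (use sub assms(2) in auto)
    finally show ?thesis .
  qed
  ultimately show ?thesis
    by blast
qed

end
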